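(* Let $T$ be an $(\mathbb{R}\cdot\mathbb{R})$-embeddable tree of cardinality at most $2^{\aleph_0}$, where $\mathbb{R}\cdot\mathbb{R}$ is the lexicographic product. Then the one-point compactification $\alpha T$ is $3$-determined.
   Context: All topological spaces are Hausdorff. A tree is a partially ordered set $(T,<)$ with a minimum element $0$ such that for every $t\in T$ the set $[0,t)=\{x\in T: x<t\}$ is well ordered, and every two elements $s,t\in T$ have a greatest lower bound $s\wedge t$. $T$ carries the interval topology, generated by the sets $(s,t]=\{x\in T: s<x\leq t\}$ together with $\{0\}$; it is locally compact and every interval $[0,t]$ is compact and open. The one-point compactification is $\alpha T=T\cup\{\infty\}$, where $T$ is an open subspace and basic neighborhoods of $\infty$ are the sets $\alpha T\setminus\bigcup_{i<n}[0,t_i]$ with $n\in\omega$ and $t_0,\dots,t_{n-1}\in T$. A compact space $K$ is $n$-determined if there are a second countable space $S$ and an upper semicontinuous set-valued map $\Phi$ assigning to each $s\in S$ a subset $\Phi(s)\subseteq K$ with at most $n$ elements, such that $K=\bigcup_{s\in S}\Phi(s)$. (Upper semicontinuous: $\{s\in S:\Phi(s)\subseteq V\}$ is open for each open $V\subseteq K$.) For linearly ordered sets $X,Y$, the lexicographic product $X\cdot Y$ is $X\times Y$ ordered by $(x_0,y_0)<(x_1,y_1)$ iff $x_0<x_1$, or $x_0=x_1$ and $y_0<y_1$. For a linearly ordered set $X$, $T$ is $X$-embeddable if there is a function $f:T\to X$ with $f(s)<f(t)$ whenever $s<t$ in $T$ ($f$ need not be one-to-one). *)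

theory Defs
  imports "HOL-Analysis.Analysis"
begin

section \<open>Trees\<close>

class meet_tree = order_bot + semilattice_inf +
  assumes well_order_below: "well_order_on {..<t} {(x, y). x \<le> y \<and> y < t}"

definition tree_topology :: "'a::meet_tree topology"
  where "tree_topology = topology_generated_by (insert {bot} {{s<..t} | s t. True})"

text \<open>Here \<open>X\<close> is a strict order, given as a set of pairs.\<close>

definition embeddable_tree :: "'a::meet_tree itself \<Rightarrow> 'b rel \<Rightarrow> bool"
  where "embeddable_tree _ X \<longleftrightarrow> (\<exists>f :: 'a \<Rightarrow> 'b. \<forall>s t. s < t \<longrightarrow> (f s, f t) \<in> X)"

definition real_lex_real :: "(real \<times> real) rel"
  where "real_lex_real = {(x, y). x < y} <*lex*> {(x, y). x < y}"


section \<open>Determined spaces\<close>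

definition upper_semicontinuous :: "'s topology \<Rightarrow> 'k topology \<Rightarrow> ('s \<Rightarrow> 'k set) \<Rightarrow> bool"
  where "upper_semicontinuous S K \<Phi> \<longleftrightarrow>
    (\<forall>s \<in> topspace S. \<Phi> s \<subseteq> topspace K) \<and>
    (\<forall>V. openin K V \<longrightarrow> openin S {s \<in> topspace S. \<Phi> s \<subseteq> V})"

text \<open>
  All spaces are Hausdorff. A second countable Hausdorff space has at most continuum many points,
  so it loses no generality to take its points to be reals (with an arbitrary topology on a set of
  reals, unrelated to the usual one); see \<open>n_determinedI\<close> below.
\<close>

definition n_determined :: "nat \<Rightarrow> 'k topology \<Rightarrow> bool"
  where "n_determined n K \<longleftrightarrow>
    compact_space K \<and> Hausdorff_space K \<and>
    (\<exists>(S :: real topology) \<Phi>.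
      second_countable S \<and> Hausdorff_space S \<and>
      upper_semicontinuous S K \<Phi> \<and>
      (\<forall>s \<in> topspace S. finite (\<Phi> s) \<and> card (\<Phi> s) \<le> n) \<and>
      topspace K = (\<Union>s \<in> topspace S. \<Phi> s))"

lemma second_countable_Hausdorff_lepoll_real:
  assumes "second_countable S" "Hausdorff_space S"
  shows "topspace S \<lesssim> (UNIV :: real set)"
proof -
  obtain B where B: "countable B" "\<And>V. V \<in> B \<Longrightarrow> openin S V"
    and base: "\<And>U x. openin S U \<Longrightarrow> x \<in> U \<Longrightarrow> \<exists>V \<in> B. x \<in> V \<and> V \<subseteq> U"
    using assms(1) unfolding second_countable_def by metis
  define g where "g x = to_nat_on B ` {V \<in> B. x \<in> V}" for x
  have "inj_on g (topspace S)"
  proof (rule inj_onI, rule ccontr)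
    fix x y assume xy: "x \<in> topspace S" "y \<in> topspace S" "g x = g y" "x \<noteq> y"
    then obtain U V where U: "openin S U" "x \<in> U" "openin S V" "y \<in> V" "disjnt U V"
      using assms(2) unfolding Hausdorff_space_def by metis
    then obtain W where W: "W \<in> B" "x \<in> W" "W \<subseteq> U" using base by metis
    then have "to_nat_on B W \<in> g y" using xy(3) unfolding g_def by auto
    then obtain W' where W': "W' \<in> B" "y \<in> W'" "to_nat_on B W = to_nat_on B W'"
      unfolding g_def by auto
    then have "W = W'" using inj_on_to_nat_on[OF B(1)] W(1) by (auto dest: inj_onD)
    then show False using U W W' by (auto simp: disjnt_def)
  qed
  then have "topspace S \<lesssim> (UNIV :: nat set set)"
    unfolding lepoll_def by blast
  then show ?thesis
    using nat_sets_eqpoll_reals lepoll_trans eqpoll_imp_lepoll by blast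
qed

lemma n_determinedI:
  fixes S :: "'s topology"
  assumes K: "compact_space K" "Hausdorff_space K"
    and S: "second_countable S" "Hausdorff_space S"
    and usc: "upper_semicontinuous S K \<Phi>"
    and fin: "\<And>s. s \<in> topspace S \<Longrightarrow> finite (\<Phi> s) \<and> card (\<Phi> s) \<le> n"
    and cover: "topspace K = (\<Union>s \<in> topspace S. \<Phi> s)"
  shows "n_determined n K"
proof -
  obtain h :: "'s \<Rightarrow> real" where h: "inj_on h (topspace S)"
    using second_countable_Hausdorff_lepoll_real[OF S] unfolding lepoll_def by blast
  define g where "g = inv_into (topspace S) h"
  have gh: "g (h x) = x" if "x \<in> topspace S" for x
    using h that by (simp add: g_def)
  define R where "R = pullback_topology (h ` topspace S) g S"
  have topR: "topspace R = h ` topspace S"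
    unfolding R_def topspace_pullback_topology using gh by auto
  have openR: "openin R V \<longleftrightarrow> (\<exists>U. openin S U \<and> V = h ` U)" for V
  proof -
    have "g -` U \<inter> h ` topspace S = h ` U" if "openin S U" for U
      using openin_subset[OF that] gh by auto
    then show ?thesis unfolding R_def openin_pullback_topology by metis
  qed
  have "homeomorphic_map S R h"
  proof (rule bijective_open_imp_homeomorphic_map)
    show "continuous_map S R h"
      unfolding continuous_map_def
    proof (intro conjI allI impI)
      show "h \<in> topspace S \<rightarrow> topspace R" using topR by auto
      fix V assume "openin R V"
      then obtain U where U: "openin S U" "V = h ` U" unfolding openR by blast
      have "{x \<in> topspace S. h x \<in> V} = U"
        using h openin_subset[OF U(1)] U(2) by (auto dest: inj_onD)
      then show "openin S {x \<in> topspace S. h x \<in> V}" using U(1) by simp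
    qed
    show "open_map S R h" unfolding open_map_def openR by blast
    show "h ` topspace S = topspace R" "inj_on h (topspace S)" using h topR by auto
  qed
  then have hom: "S homeomorphic_space R"
    using homeomorphic_map_imp_homeomorphic_space by blast
  have usc': "upper_semicontinuous R K (\<Phi> \<circ> g)"
    unfolding upper_semicontinuous_def
  proof (intro conjI allI impI)
    show "\<forall>s\<in>topspace R. (\<Phi> \<circ> g) s \<subseteq> topspace K"
      using usc gh unfolding upper_semicontinuous_def topR by auto
    fix V assume "openin K V"
    then have "openin S {s \<in> topspace S. \<Phi> s \<subseteq> V}"
      using usc unfolding upper_semicontinuous_def by blast
    moreover have "{s \<in> topspace R. (\<Phi> \<circ> g) s \<subseteq> V} = h ` {s \<in> topspace S. \<Phi> s \<subseteq> V}"
      using gh unfolding topR by auto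
    ultimately show "openin R {s \<in> topspace R. (\<Phi> \<circ> g) s \<subseteq> V}"
      unfolding openR by blast
  qed
  show ?thesis
    unfolding n_determined_def
  proof (intro conjI exI)
    show "second_countable R" "Hausdorff_space R"
      using hom S homeomorphic_space_second_countability homeomorphic_Hausdorff_space by blast+
    show "upper_semicontinuous R K (\<Phi> \<circ> g)" by (fact usc')
    show "\<forall>s\<in>topspace R. finite ((\<Phi> \<circ> g) s) \<and> card ((\<Phi> \<circ> g) s) \<le> n"
      using fin gh unfolding topR by auto
    show "topspace K = (\<Union>s\<in>topspace R. (\<Phi> \<circ> g) s)"
      using cover gh unfolding topR by auto
  qed (use K in auto)
qed


section \<open>The interval topology\<close>

lemma tree_wf: "wf {(x :: 'a::meet_tree, y). x < y}"
proof (rule wfI_min)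
  fix x :: 'a and Q assume x: "x \<in> Q"
  let ?r = "{(y, z). y \<le> z \<and> z < x}"
  show "\<exists>z\<in>Q. \<forall>y. (y, z) \<in> {(x, y). x < y} \<longrightarrow> y \<notin> Q"
  proof (cases "\<exists>y\<in>Q. y < x")
    case True
    have "wf (?r - Id)"
      using well_order_below[of x] unfolding well_order_on_def by blast
    moreover obtain y where "y \<in> Q \<inter> {..<x}" using True by blast
    ultimately obtain z where z: "z \<in> Q \<inter> {..<x}" "\<And>y. (y, z) \<in> ?r - Id \<Longrightarrow> y \<notin> Q \<inter> {..<x}"
      by (rule wfE_min) (rule that)
    have "y \<notin> Q" if "y < z" for y
      using z(2)[of y] z(1) that order.strict_trans[of y z x] order.strict_implies_order[of y z] by auto
    then show ?thesis
      using z(1) by blast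
  qed (use x in auto)
qed

lemma tree_linear_below:
  fixes t :: "'a::meet_tree"
  assumes "x \<le> t" "y \<le> t"
  shows "x \<le> y \<or> y \<le> x"
proof -
  have "total_on {..<t} {(x, y). x \<le> y \<and> y < t}"
    using well_order_below[of t] unfolding well_order_on_def linear_order_on_def by blast
  then show ?thesis
    using assms unfolding total_on_def
    by (cases "x = t \<or> y = t \<or> x = y") (auto simp: order.strict_iff_order)
qed

lemma topspace_tree_topology [simp]: "topspace (tree_topology :: 'a::meet_tree topology) = UNIV"
proof -
  have "\<exists>B \<in> insert {bot} {{s<..t} | s t. True}. t \<in> B" for t :: 'a
  proof (cases "t = bot")
    case False
    then have "t \<in> {bot<..t}" using bot.not_eq_extremum[of t] by simp
    then show ?thesis by blast
  qed simp
  then show ?thesis unfolding tree_topology_def topology_generated_by_topspace by blast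
qed

lemma openin_tree_topology:
  fixes U :: "'a::meet_tree set"
  shows "openin tree_topology U \<longleftrightarrow> (\<forall>t\<in>U. t \<noteq> bot \<longrightarrow> (\<exists>s<t. {s<..t} \<subseteq> U))"
proof
  assume "openin tree_topology U"
  then have "generate_topology_on (insert {bot} {{s<..t} | s t. True}) U"
    unfolding tree_topology_def openin_topology_generated_by_iff .
  then show "\<forall>t\<in>U. t \<noteq> bot \<longrightarrow> (\<exists>s<t. {s<..t} \<subseteq> U)"
  proof induction
    case (Int a b)
    show ?case
    proof (intro ballI impI)
      fix t assume t: "t \<in> a \<inter> b" "t \<noteq> bot"
      then obtain s1 s2 where s: "s1 < t" "{s1<..t} \<subseteq> a" "s2 < t" "{s2<..t} \<subseteq> b"
        using Int by (metis IntE)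
      then have "s1 \<le> s2 \<or> s2 \<le> s1" using tree_linear_below[of s1 t s2] by auto
      then show "\<exists>s<t. {s<..t} \<subseteq> a \<inter> b"
      proof
        assume "s1 \<le> s2" then have "{s2<..t} \<subseteq> {s1<..t}" by auto
        then show ?thesis using s by blast
      next
        assume "s2 \<le> s1" then have "{s1<..t} \<subseteq> {s2<..t}" by auto
        then show ?thesis using s by blast
      qed
    qed
  next
    case (UN K)
    show ?case using UN.IH by blast
  next
    case (Basis B)
    then show ?case by fastforce
  qed auto
next
  assume U: "\<forall>t\<in>U. t \<noteq> bot \<longrightarrow> (\<exists>s<t. {s<..t} \<subseteq> U)"
  have B: "openin tree_topology {bot :: 'a}" "openin tree_topology {s<..t}" for s t :: 'a
    unfolding tree_topology_def by (rule topology_generated_by_Basis, auto)+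
  show "openin tree_topology U"
  proof (subst openin_subopen, intro ballI)
    fix t assume t: "t \<in> U"
    show "\<exists>V. openin tree_topology V \<and> t \<in> V \<and> V \<subseteq> U"
    proof (cases "t = bot")
      case True then show ?thesis using B(1) t by blast
    next
      case False
      then obtain s where "s < t" "{s<..t} \<subseteq> U" using U t by blast
      then show ?thesis using B(2)[of s t] by (intro exI[of _ "{s<..t}"]) auto
    qed
  qed
qed

lemma openin_tree_atMost: "openin tree_topology {..t :: 'a::meet_tree}"
  unfolding openin_tree_topology
proof (intro ballI impI exI conjI)
  fix x :: 'a assume x: "x \<in> {..t}" "x \<noteq> bot"
  then show "bot < x" using bot.not_eq_extremum by blast
  show "{bot<..x} \<subseteq> {..t}" using x by (auto intro: order_trans)
qed

lemma compactin_tree_atMost: "compactin tree_topology {..t :: 'a::meet_tree}"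
proof (induction t rule: wf_induct_rule[OF tree_wf])
  case (1 t)
  show ?case unfolding compactin_def
  proof (intro conjI allI impI)
    fix \<U> assume \<U>: "Ball \<U> (openin tree_topology) \<and> {..t} \<subseteq> \<Union> \<U>"
    then obtain U where U: "U \<in> \<U>" "t \<in> U" by auto
    show "\<exists>\<F>. finite \<F> \<and> \<F> \<subseteq> \<U> \<and> {..t} \<subseteq> \<Union> \<F>"
    proof (cases "t = bot")
      case True
      then have "{..t} \<subseteq> \<Union>{U}" using U by (auto simp: bot_unique)
      then show ?thesis using U by (intro exI[of _ "{U}"]) auto
    next
      case False
      have "openin tree_topology U" using U(1) \<U> by blast
      then obtain s where s: "s < t" "{s<..t} \<subseteq> U"
        using U(2) False unfolding openin_tree_topology by blast
      have "compactin tree_topology {..s}" using 1 s(1) by auto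
      moreover have "{..s} \<subseteq> \<Union> \<U>" using \<U> s(1) by auto
      ultimately obtain \<F> where F: "finite \<F>" "\<F> \<subseteq> \<U>" "{..s} \<subseteq> \<Union> \<F>"
        using \<U> unfolding compactin_def by meson
      have "x \<le> s \<or> s < x" if "x \<le> t" for x
        using tree_linear_below[of x t s] s(1) that order.strict_implies_order[of s t]
        by (auto simp: order.order_iff_strict)
      then have "{..t} \<subseteq> {..s} \<union> {s<..t}" by fastforce
      then have "{..t} \<subseteq> \<Union> (insert U \<F>)" using F(3) s(2) by blast
      then show ?thesis using F U by (intro exI[of _ "insert U \<F>"]) auto
    qed
  qed simp
qed

lemma Hausdorff_tree_topology: "Hausdorff_space (tree_topology :: 'a::meet_tree topology)"
proof -
  have *: "\<exists>U V. openin tree_topology U \<and> openin tree_topology V \<and> x \<in> U \<and> y \<in> V \<and> disjnt U V"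
    if "\<not> y \<le> x" for x y :: 'a
  proof (intro exI conjI)
    show "openin tree_topology {..x}" "x \<in> {..x}"
      using openin_tree_atMost by auto
    have "openin tree_topology {inf x y<..y}"
      unfolding tree_topology_def by (rule topology_generated_by_Basis) auto
    then show "openin tree_topology {inf x y<..y}" .
    show "y \<in> {inf x y<..y}"
      using that by (metis greaterThanAtMost_iff inf_le1 inf_le2 order.not_eq_order_implies_strict order_refl)
    show "disjnt {..x} {inf x y<..y}"
      unfolding disjnt_def by (auto simp: less_le_not_le)
  qed
  show ?thesis unfolding Hausdorff_space_def
  proof (intro allI impI)
    fix x y :: 'a assume xy: "x \<in> topspace tree_topology \<and> y \<in> topspace tree_topology \<and> x \<noteq> y"
    then consider "\<not> y \<le> x" | "\<not> x \<le> y" by force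
    then show "\<exists>U V. openin tree_topology U \<and> openin tree_topology V \<and> x \<in> U \<and> y \<in> V \<and> disjnt U V"
      by cases (use *[of y x] *[of x y] disjnt_sym in blast)+
  qed
qed

text \<open>
  The library's one-point compactification \<open>Alexandroff_compactification\<close>, with \<open>None\<close> as the
  point at infinity, therefore has the usual neighbourhoods: the complements of the finite unions
  of sets \<open>{..t}\<close> form a neighbourhood base at \<open>None\<close>.
\<close>

lemma openin_Alexandroff_tree:
  fixes V :: "'a::meet_tree option set"
  shows "openin (Alexandroff_compactification tree_topology) V \<longleftrightarrow>
    openin tree_topology (Some -` V) \<and>
    (None \<in> V \<longrightarrow> (\<exists>F. finite F \<and> UNIV - Some ` (\<Union>t\<in>F. {..t}) \<subseteq> V))"
    (is "?L \<longleftrightarrow> ?R")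
proof
  assume ?L
  then consider U where "openin tree_topology U" "V = Some ` U"
    | C where "compactin tree_topology C" "closedin tree_topology C" "V = insert None (Some ` (UNIV - C))"
    unfolding openin_Alexandroff_compactification by auto
  then show ?R
  proof cases
    case 1
    have "Some -` V = U" using 1 by auto
    then show ?thesis using 1 by auto
  next
    case 2
    have "\<exists>\<F>. finite \<F> \<and> \<F> \<subseteq> range atMost \<and> C \<subseteq> \<Union> \<F>"
      using 2(1) unfolding compactin_def
      by (elim conjE allE[of _ "range atMost"]) (auto simp: openin_tree_atMost)
    then obtain F where F: "finite F" "C \<subseteq> (\<Union>t\<in>F. {..t})"
      by (metis finite_subset_image)
    have "Some -` V = UNIV - C" using 2 by auto
    then have "openin tree_topology (Some -` V)" using 2 by (simp add: closedin_def)
    moreover have "UNIV - Some ` (\<Union>t\<in>F. {..t}) \<subseteq> V"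
    proof
      fix v assume "v \<in> UNIV - Some ` (\<Union>t\<in>F. {..t})"
      then show "v \<in> V" using F(2) 2(3) by (cases v) (auto simp: image_iff)
    qed
    ultimately show ?thesis using F(1) by blast
  qed
next
  assume R: ?R
  show ?L
  proof (cases "None \<in> V")
    case False
    have "v \<in> Some ` (Some -` V)" if "v \<in> V" for v
      using False that by (cases v) auto
    then have "V = Some ` (Some -` V)" by auto
    then show ?thesis using R openin_Alexandroff_compactification by blast
  next
    case True
    then obtain F where F: "finite F" "UNIV - Some ` (\<Union>t\<in>F. {..t}) \<subseteq> V" using R by blast
    define C where "C = UNIV - Some -` V"
    have closed: "closedin tree_topology C"
      using R by (simp add: C_def closedin_def double_diff)
    have "compactin tree_topology (\<Union>t\<in>F. {..t})"
      using F(1) by (intro compactin_Union) (auto simp: compactin_tree_atMost)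
    moreover have "C \<subseteq> (\<Union>t\<in>F. {..t})" using F(2) by (auto simp: C_def)
    ultimately have "compactin tree_topology C" using closed closed_compactin by blast
    moreover have "v \<in> insert None (Some ` (UNIV - C))" if "v \<in> V" for v
      using that by (cases v) (auto simp: C_def)
    then have "V = insert None (Some ` (UNIV - C))"
      using True by (auto simp: C_def)
    ultimately show ?thesis
      using closed unfolding openin_Alexandroff_compactification by auto
  qed
qed

end

theory Submission
  imports Defs
begin

text \<open>
  Say \<open>a\<close> is isolated if \<open>{a}\<close> is open. For a set \<open>Q\<close> of isolated nodes, the function sending \<open>x\<close>
  to (a real code of) the first element of \<open>Q\<close> below \<open>x\<close> is locally constant. Let \<open>f = (f1, f2)\<close> be
  the embedding. Taking \<open>Q = {a. f1 a > q}\<close> for all rational \<open>q\<close> gives a continuous map \<open>g\<close> into a second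
  countable space whose fibres are convex subtrees, each with a least element (its root). On a
  fibre, \<open>f2\<close> plays the role of \<open>f1\<close>, and the sets \<open>{a. f2 a > q}\<close> yield a map \<open>k\<close> which is
  continuous on \<open>T\<close> away from the roots and injective on every fibre. Hence \<open>x \<mapsto> (g x, k x)\<close> is
  an injection of \<open>T\<close> onto a second countable space, and the set-valued map sending \<open>(g x, k x)\<close> to
  \<open>x\<close>, the root of \<open>x\<close>, and \<open>\<infinity>\<close> is upper semicontinuous: the root absorbs the cluster points at which
  \<open>k\<close> fails to be continuous.
\<close>

section \<open>Least elements and isolated nodes\<close>

lemma tree_least_below:
  fixes x :: "'a::meet_tree"
  assumes "a \<le> x" "P a" "\<And>z. P z \<Longrightarrow> z \<le> x"
  shows "P (LEAST z. P z)" and "P z \<Longrightarrow> (LEAST z. P z) \<le> z"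
proof -
  have "a \<in> Collect P" using assms(2) by simp
  then obtain m where m: "P m" "\<And>y. y < m \<Longrightarrow> \<not> P y"
    using wfE_min[OF tree_wf, of a "Collect P"] by auto
  \<comment> \<open>All nodes satisfying \<open>P\<close> lie below \<open>x\<close>, hence are
    pairwise comparable, so the minimal node \<open>m\<close> is even least.\<close>
  have le: "m \<le> z" if "P z" for z
    using tree_linear_below[of m x z] assms(3) m that by (auto simp: order.order_iff_strict)
  have eq: "(LEAST z. P z) = m"
    by (rule Least_equality) (use m(1) le in auto)
  show "P (LEAST z. P z)" using m(1) eq by simp
  show "(LEAST z. P z) \<le> z" if "P z" using le[OF that] eq by simp
qed

definition isolated :: "'a::meet_tree \<Rightarrow> bool"
  where "isolated a \<longleftrightarrow> openin tree_topology {a}"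

text \<open>The least node \<open>a\<close> of \<open>{m<..y}\<close> is an immediate successor of
  \<open>m\<close>, so \<open>{m<..a}\<close> is an open set with the single point
  \<open>a\<close>.\<close>

lemma isolated_between:
  fixes m y :: "'a::meet_tree"
  assumes "m < y"
  obtains a where "m < a" "a \<le> y" "isolated a"
proof -
  define a where "a = (LEAST z. m < z \<and> z \<le> y)"
  have a: "m < a" "a \<le> y" and least: "\<And>z. m < z \<and> z \<le> y \<Longrightarrow> a \<le> z"
    using tree_least_below[of y y "\<lambda>z. m < z \<and> z \<le> y"] assms by (auto simp: a_def)
  have "{m<..a} \<subseteq> {a}"
  proof
    fix z assume z: "z \<in> {m<..a}"
    then have "z \<le> y" using a(2) by (auto intro: order_trans)
    then have "a \<le> z" using z least by simp
    then show "z \<in> {a}" using z by simp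
  qed
  then have "isolated a"
    unfolding isolated_def openin_tree_topology using a(1) by auto
  then show thesis using that a by blast
qed

lemma openin_atLeast_isolated:
  assumes "isolated a"
  shows "openin tree_topology {a..}"
  unfolding openin_tree_topology
proof (intro ballI impI)
  fix t assume t: "t \<in> {a..}" "t \<noteq> bot"
  show "\<exists>s<t. {s<..t} \<subseteq> {a..}"
  proof (cases "t = a")
    case True
    then obtain s where "s < t" "{s<..t} \<subseteq> {a}"
      using assms t(2) unfolding isolated_def openin_tree_topology by blast
    then show ?thesis by (intro exI[of _ s]) auto
  next
    case False
    then show ?thesis using t by (intro exI[of _ a]) auto
  qed
qed

lemma openin_tree_greaterThanAtMost: "openin tree_topology {s<..t :: 'a::meet_tree}"
  unfolding tree_topology_def by (rule topology_generated_by_Basis) auto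

lemma locally_compact_tree: "locally_compact_space (tree_topology :: 'a::meet_tree topology)"
  unfolding locally_compact_space_def
  by (auto intro!: exI[of _ "{.._}"] simp: openin_tree_atMost compactin_tree_atMost)

lemma second_countable_euclidean:
  "second_countable (euclidean :: 'b::second_countable_topology topology)"
proof -
  obtain B :: "'b set set" where B: "countable B" "\<And>C. C \<in> B \<Longrightarrow> open C"
    and base: "\<And>S. open S \<Longrightarrow> \<exists>U. U \<subseteq> B \<and> S = \<Union>U"
    using univ_second_countable by blast
  show ?thesis unfolding second_countable_def
  proof (intro exI conjI allI impI ballI)
    show "openin euclidean V" if "V \<in> B" for V using B(2) that by simp
    show "\<exists>V\<in>B. x \<in> V \<and> V \<subseteq> U" if "openin euclidean U \<and> x \<in> U" for U x
      using base[of U] that by auto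
  qed (rule B(1))
qed

section \<open>Locally constant codes\<close>

definition first_code :: "('a::meet_tree \<Rightarrow> real) \<Rightarrow> 'a set \<Rightarrow> 'a \<Rightarrow> real"
  where "first_code h Q x = (if {..x} \<inter> Q = {} then 0 else h (LEAST a. a \<in> {..x} \<inter> Q))"

text \<open>Positivity reserves the default 0 of \<open>first_code\<close> for nodes with no element
  of \<open>Q\<close> below them; injectivity turns equal nonzero codes into equal nodes. Codes are
  real so that families of codes indexed by rationals live in a second countable product.\<close>

locale coded_tree =
  fixes h :: "'a::meet_tree \<Rightarrow> real"
  assumes inj_code: "inj h" and code_pos: "0 < h x"
begin

lemma first_codeE:
  assumes "{..x} \<inter> Q \<noteq> {}"
  obtains a where "a \<in> Q" "a \<le> x" "first_code h Q x = h a"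
    "\<And>b. b \<in> Q \<Longrightarrow> b \<le> x \<Longrightarrow> a \<le> b"
proof -
  define a where "a = (LEAST a. a \<in> {..x} \<inter> Q)"
  obtain c where "c \<in> {..x} \<inter> Q" using assms by blast
  then have "a \<in> {..x} \<inter> Q" "\<And>b. b \<in> {..x} \<inter> Q \<Longrightarrow> a \<le> b"
    unfolding a_def using tree_least_below[of c x "\<lambda>z. z \<in> {..x} \<inter> Q"] by blast+
  then show thesis using that[of a] assms by (auto simp: first_code_def a_def)
qed

lemma first_code_eq_0_iff: "first_code h Q x = 0 \<longleftrightarrow> {..x} \<inter> Q = {}"
  using code_pos by (auto simp: first_code_def less_imp_neq[symmetric])

lemma first_code_below:
  assumes "a \<in> Q" "a \<le> w" "w \<le> y" "\<And>b. b \<in> Q \<Longrightarrow> b \<le> y \<Longrightarrow> a \<le> b"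
  shows "first_code h Q w = h a"
proof -
  have "{..w} \<inter> Q \<noteq> {}" using assms by auto
  moreover have "(LEAST a. a \<in> {..w} \<inter> Q) = a"
    by (rule Least_equality) (use assms in \<open>auto intro: order_trans\<close>)
  ultimately show ?thesis by (simp add: first_code_def)
qed

text \<open>A first element shared by \<open>x\<close> and \<open>y\<close> lies below both, hence
  below their meet.\<close>

lemma first_code_inf:
  assumes "first_code h Q x = first_code h Q y"
  shows "first_code h Q (inf x y) = first_code h Q x"
proof (cases "{..x} \<inter> Q = {}")
  case True
  then have "{..inf x y} \<inter> Q = {}" by auto
  then show ?thesis using True by (simp add: first_code_def)
next
  case False
  then have "{..y} \<inter> Q \<noteq> {}" using assms first_code_eq_0_iff by metis
  then obtain b where b: "b \<in> Q" "b \<le> y" "first_code h Q y = h b" by (rule first_codeE)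
  obtain a where a: "a \<in> Q" "a \<le> x" "first_code h Q x = h a"
    "\<And>b. b \<in> Q \<Longrightarrow> b \<le> x \<Longrightarrow> a \<le> b" using False by (rule first_codeE) blast
  have "a = b" using a b assms inj_code by (simp add: inj_eq)
  then show ?thesis using first_code_below[of a Q "inf x y" x] a b by simp
qed

lemma first_code_convex:
  assumes "first_code h Q x = first_code h Q y" "x \<le> z" "z \<le> y"
  shows "first_code h Q z = first_code h Q y"
proof (cases "{..y} \<inter> Q = {}")
  case True
  then have "{..z} \<inter> Q = {}" using assms(3) by (auto intro: order_trans)
  then show ?thesis using True by (simp add: first_code_def)
next
  case False
  then have "{..x} \<inter> Q \<noteq> {}" using assms first_code_eq_0_iff by metis
  then obtain b where b: "b \<in> Q" "b \<le> x" "first_code h Q x = h b" by (rule first_codeE)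
  obtain a where a: "a \<in> Q" "a \<le> y" "first_code h Q y = h a"
    "\<And>b. b \<in> Q \<Longrightarrow> b \<le> y \<Longrightarrow> a \<le> b" using False by (rule first_codeE) blast
  have "a = b" using a b assms inj_code by (simp add: inj_eq)
  then show ?thesis using first_code_below[of a Q z y] a b assms by (auto intro: order_trans)
qed

text \<open>Within \<open>{..y}\<close> the code can change only at the first element
  \<open>a\<close> of \<open>Q\<close>, and the interval from \<open>a\<close> to \<open>y\<close>
  is open because \<open>a\<close> is isolated.\<close>

lemma first_code_locally_constant:
  assumes "\<And>a. a \<in> Q \<Longrightarrow> isolated a"
  obtains U where "openin tree_topology U" "y \<in> U" "\<And>w. w \<in> U \<Longrightarrow> first_code h Q w = first_code h Q y"
proof (cases "{..y} \<inter> Q = {}")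
  case True
  show thesis
  proof (rule that[of "{..y}"])
    fix w assume "w \<in> {..y}"
    then have "{..w} \<inter> Q = {}" using True by (auto intro: order_trans)
    then show "first_code h Q w = first_code h Q y" using True by (simp add: first_code_def)
  qed (auto simp: openin_tree_atMost)
next
  case False
  then obtain a where a: "a \<in> Q" "a \<le> y" "first_code h Q y = h a"
    "\<And>b. b \<in> Q \<Longrightarrow> b \<le> y \<Longrightarrow> a \<le> b" by (rule first_codeE) blast
  show thesis
  proof (rule that[of "{..y} \<inter> {a..}"])
    show "openin tree_topology ({..y} \<inter> {a..})"
      using a(1) assms openin_atLeast_isolated openin_tree_atMost by blast
    fix w assume "w \<in> {..y} \<inter> {a..}"
    then show "first_code h Q w = first_code h Q y"
      using first_code_below[of a Q w y] a by auto
  qed (use a in auto)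
qed

end

section \<open>Fibres of \<open>g\<close> and their roots\<close>

locale lex_embedded_tree = coded_tree h for h :: "'a::meet_tree \<Rightarrow> real" +
  fixes f1 f2 :: "'a \<Rightarrow> real"
  assumes f1_mono: "s \<le> t \<Longrightarrow> f1 s \<le> f1 t"
    and f2_less: "s < t \<Longrightarrow> f1 s = f1 t \<Longrightarrow> f2 s < f2 t"
begin

definition g :: "'a \<Rightarrow> rat \<Rightarrow> real"
  where "g x q = first_code h {a. isolated a \<and> of_rat q < f1 a} x"

text \<open>The condition \<open>g a = g x\<close> makes the set of candidates depend on
  \<open>x\<close> only through its fibre. On one fibre each coordinate of \<open>k\<close> is thus
  a \<open>first_code\<close> for a fixed set.\<close>

definition k :: "'a \<Rightarrow> rat \<Rightarrow> real"
  where "k x q = first_code h {a. isolated a \<and> of_rat q < f2 a \<and> g a = g x} x"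

definition fibre_root :: "'a \<Rightarrow> 'a"
  where "fibre_root x = (LEAST z. z \<le> x \<and> g z = g x)"

lemma g_inf: "g x = g y \<Longrightarrow> g (inf x y) = g x"
  using first_code_inf unfolding g_def fun_eq_iff by blast

lemma g_convex: "g x = g y \<Longrightarrow> x \<le> z \<Longrightarrow> z \<le> y \<Longrightarrow> g z = g y"
  using first_code_convex unfolding g_def fun_eq_iff by blast

lemma fibre_root:
  shows fibre_root_le: "fibre_root x \<le> x"
    and g_fibre_root: "g (fibre_root x) = g x"
    and fibre_root_least: "z \<le> x \<Longrightarrow> g z = g x \<Longrightarrow> fibre_root x \<le> z"
  using tree_least_below[of x x "\<lambda>z. z \<le> x \<and> g z = g x"] unfolding fibre_root_def by auto

text \<open>The meet of \<open>x\<close> and \<open>y\<close> stays in their common fibre, so the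
  root of either node lies below the other node, and leastness gives both inequalities.\<close>

lemma fibre_root_cong:
  assumes "g x = g y"
  shows "fibre_root x = fibre_root y"
proof -
  have *: "fibre_root y \<le> fibre_root x" if "g x = g y" for x y
  proof (rule fibre_root_least)
    have "fibre_root x \<le> inf x y" using g_inf[OF that] by (intro fibre_root_least) auto
    then show "fibre_root x \<le> y" by simp
    show "g (fibre_root x) = g y" using that g_fibre_root by simp
  qed
  show ?thesis using *[OF assms] *[OF assms[symmetric]] by (rule antisym[rotated])
qed

text \<open>A rational strictly between \<open>f1 b\<close> and \<open>f1 a\<close> would be
  detected by \<open>g\<close> at \<open>a\<close>, through \<open>a\<close> itself, but not at
  \<open>b\<close>. On a fibre \<open>f1\<close> may still jump at a limit node; this bound at
  isolated nodes replaces constancy.\<close>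

lemma f1_isolated_le:
  assumes "isolated a" "g a = g b"
  shows "f1 a \<le> f1 b"
proof (rule ccontr)
  assume "\<not> ?thesis"
  then obtain q where q: "f1 b < of_rat q" "of_rat q < f1 a" using of_rat_dense[of "f1 b" "f1 a"] by auto
  have "g a q \<noteq> 0"
    using assms(1) q unfolding g_def first_code_eq_0_iff by auto
  moreover have "g b q = 0"
    unfolding g_def first_code_eq_0_iff using q(1) f1_mono[of _ b] by fastforce
  ultimately show False using assms(2) by simp
qed

text \<open>Otherwise there is an isolated \<open>a\<close> above the meet \<open>m\<close> with
  \<open>a \<le> y\<close>, and \<open>f1\<close> agrees at \<open>m\<close> and \<open>a\<close>.
  At a rational between \<open>f2 m\<close> and \<open>f2 a\<close>, \<open>k\<close> detects
  \<open>a\<close> below \<open>y\<close> but nothing below \<open>m\<close>, whereas a common code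
  of \<open>x\<close> and \<open>y\<close> would pass to \<open>m\<close>.\<close>

lemma fibre_injective:
  assumes "g x = g y" "k x = k y"
  shows "y \<le> x"
proof (rule ccontr)
  assume "\<not> ?thesis"
  define m where "m = inf x y"
  have "m \<noteq> y" using \<open>\<not> y \<le> x\<close> by (metis inf_le1 m_def)
  then have m: "m < y" by (simp add: m_def order.not_eq_order_implies_strict)
  then obtain a where a: "m < a" "a \<le> y" "isolated a" by (rule isolated_between)
  have gm: "g m = g y" using g_inf[OF assms(1)] assms(1) by (simp add: m_def)
  have ga: "g a = g y" by (rule g_convex[OF gm]) (use a in auto)
  have f1a: "f1 a = f1 m"
    using f1_isolated_le[of a m] f1_mono[of m a] a ga gm by simp
  then have "f2 m < f2 a" using f2_less[OF a(1)] by simp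
  then obtain q where q: "f2 m < of_rat q" "of_rat q < f2 a" using of_rat_dense by blast
  define Q where "Q = {a. isolated a \<and> of_rat q < f2 a \<and> g a = g y}"
  have "first_code h Q x = first_code h Q y"
    using fun_cong[OF assms(2), of q] assms(1) unfolding k_def Q_def by simp
  then have "first_code h Q m = first_code h Q y"
    using first_code_inf by (simp add: m_def)
  moreover have "first_code h Q y \<noteq> 0"
    using a q ga unfolding first_code_eq_0_iff Q_def by auto
  moreover have "b \<notin> Q" if "b \<le> m" for b
  proof
    assume b: "b \<in> Q"
    \<comment> \<open>The isolated node \<open>a\<close> squeezes \<open>f1 b\<close> between
      \<open>f1 a\<close> and \<open>f1 m\<close>, which are equal, so \<open>f2\<close> can be
      compared at \<open>b\<close> and \<open>m\<close>.\<close>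
    then have "f1 a \<le> f1 b" using f1_isolated_le[of a b] a ga by (simp add: Q_def)
    then have "f1 b = f1 m" using f1_mono[OF that] f1a by simp
    then have "f2 b \<le> f2 m" using f2_less[of b m] that by (cases "b = m") (auto simp: order.strict_iff_order)
    then show False using b q by (simp add: Q_def)
  qed
  ultimately show False using first_code_eq_0_iff[of Q m] by auto
qed

section \<open>Separation and upper semicontinuity\<close>

definition G :: "'a \<Rightarrow> (rat \<Rightarrow> real) \<times> (rat \<Rightarrow> real)"
  where "G x = (g x, k x)"

lemma inj_G: "inj G"
  by (rule injI) (auto simp: G_def intro!: antisym fibre_injective)

text \<open>Covering a compact set by such \<open>U\<close> yields upper semicontinuity at
  \<open>G x\<close>. If \<open>y\<close> lies in another fibre, \<open>g\<close> separates, since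
  \<open>w\<close> and its root have the same \<open>g\<close>; in the fibre of \<open>x\<close>,
  \<open>k\<close> separates on a neighbourhood of \<open>y\<close> that omits the root.\<close>

lemma separate_point:
  assumes "y \<noteq> x" "y \<noteq> fibre_root x"
  obtains U W where "openin tree_topology U" "y \<in> U" "open W" "G x \<in> W"
    "\<And>w. G w \<in> W \<Longrightarrow> w \<notin> U \<and> fibre_root w \<notin> U"
proof (cases "g y = g x")
  case False
  then obtain q where q: "g y q \<noteq> g x q" by auto
  let ?Q = "{a. isolated a \<and> of_rat q < f1 a}"
  have "isolated a" if "a \<in> ?Q" for a using that by simp
  then obtain U where U: "openin tree_topology U" "y \<in> U"
    "\<And>w. w \<in> U \<Longrightarrow> first_code h ?Q w = first_code h ?Q y"
    using first_code_locally_constant[of ?Q y] by blast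
  have gU: "g w q = g y q" if "w \<in> U" for w using U(3)[OF that] by (simp add: g_def)
  have "open {p :: (rat \<Rightarrow> real) \<times> (rat \<Rightarrow> real). fst p q \<noteq> g y q}"
    by (intro open_Collect_neq continuous_intros continuous_on_product_then_coordinatewise)
  then show thesis
  proof (rule that[OF U(1,2)])
    show "G x \<in> {p. fst p q \<noteq> g y q}" using q by (simp add: G_def)
    fix w assume "G w \<in> {p. fst p q \<noteq> g y q}"
    then have "g w q \<noteq> g y q" by (simp add: G_def)
    then show "w \<notin> U \<and> fibre_root w \<notin> U"
      using gU[of w] gU[of "fibre_root w"] g_fibre_root[of w] by auto
  qed
next
  case True
  have "fibre_root y \<noteq> y" using assms(2) fibre_root_cong[OF True] by simp
  then have ry: "fibre_root y < y" using fibre_root_le order.not_eq_order_implies_strict by blast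
  have "k y \<noteq> k x" using inj_G assms(1) True by (auto simp: G_def inj_def)
  then obtain q where q: "k y q \<noteq> k x q" by auto
  define Q where "Q = {a. isolated a \<and> of_rat q < f2 a \<and> g a = g y}"
  have "isolated a" if "a \<in> Q" for a using that by (simp add: Q_def)
  then obtain U where U: "openin tree_topology U" "y \<in> U"
    "\<And>w. w \<in> U \<Longrightarrow> first_code h Q w = first_code h Q y"
    using first_code_locally_constant[of Q y] by blast
  \<comment> \<open>By convexity this interval stays in the fibre of \<open>y\<close>, so
    \<open>Q\<close> computes \<open>k\<close> on it. Being open at its lower end, it omits the only
    root in that fibre; it contains \<open>y\<close> because \<open>y\<close> is not that
    root.\<close>
  let ?U = "U \<inter> {fibre_root y<..y}"
  have in_fibre: "g w = g y" if "w \<in> ?U" for w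
    using g_convex[OF g_fibre_root[of y], of w] that by auto
  have kU: "k w q = k y q" if "w \<in> ?U" for w
    using U(3)[of w] in_fibre[OF that] that by (simp add: k_def Q_def)
  have no_root: "fibre_root w \<notin> ?U" for w
  proof
    assume w: "fibre_root w \<in> ?U"
    then have "g w = g y" using in_fibre[OF w] g_fibre_root[of w] by simp
    then have "fibre_root w = fibre_root y" by (rule fibre_root_cong)
    then show False using w by simp
  qed
  show thesis
  proof (rule that)
    show "openin tree_topology ?U" using U(1) openin_tree_greaterThanAtMost by blast
    show "y \<in> ?U" using U(2) ry by simp
    show "open {p :: (rat \<Rightarrow> real) \<times> (rat \<Rightarrow> real). snd p q \<noteq> k y q}"
      by (intro open_Collect_neq continuous_intros continuous_on_product_then_coordinatewise)
    show "G x \<in> {p. snd p q \<noteq> k y q}" using q by (simp add: G_def)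
    show "w \<notin> ?U \<and> fibre_root w \<notin> ?U" if "G w \<in> {p. snd p q \<noteq> k y q}" for w
      using that kU[of w] no_root[of w] by (simp add: G_def) blast
  qed
qed

lemma separate_compact:
  assumes C: "compactin tree_topology C" and "x \<notin> C" "fibre_root x \<notin> C"
  obtains W where "open W" "G x \<in> W" "\<And>w. G w \<in> W \<Longrightarrow> w \<notin> C \<and> fibre_root w \<notin> C"
proof -
  define \<U> where "\<U> = {U. openin tree_topology U \<and>
    (\<exists>W. open W \<and> G x \<in> W \<and> (\<forall>w. G w \<in> W \<longrightarrow> w \<notin> U \<and> fibre_root w \<notin> U))}"
  have "C \<subseteq> \<Union>\<U>"
  proof
    fix y assume "y \<in> C"
    then have "y \<noteq> x" "y \<noteq> fibre_root x" using assms by auto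
    then show "y \<in> \<Union>\<U>" by (rule separate_point) (auto simp: \<U>_def)
  qed
  then obtain \<F> where F: "finite \<F>" "\<F> \<subseteq> \<U>" "C \<subseteq> \<Union>\<F>"
    using C unfolding compactin_def \<U>_def by (metis (no_types, lifting) mem_Collect_eq)
  have "\<forall>U\<in>\<F>. \<exists>W. open W \<and> G x \<in> W \<and> (\<forall>w. G w \<in> W \<longrightarrow> w \<notin> U \<and> fibre_root w \<notin> U)"
    using F(2) by (auto simp: \<U>_def)
  then obtain W where W: "\<And>U. U \<in> \<F> \<Longrightarrow> open (W U) \<and> G x \<in> W U \<and>
      (\<forall>w. G w \<in> W U \<longrightarrow> w \<notin> U \<and> fibre_root w \<notin> U)"
    by metis
  show thesis
  proof (rule that[of "\<Inter>U\<in>\<F>. W U"])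
    show "open (\<Inter>U\<in>\<F>. W U)" "G x \<in> (\<Inter>U\<in>\<F>. W U)" using W F(1) by auto
    show "w \<notin> C \<and> fibre_root w \<notin> C" if "G w \<in> (\<Inter>U\<in>\<F>. W U)" for w
    proof -
      have "w \<notin> U \<and> fibre_root w \<notin> U" if "U \<in> \<F>" for U
        using W[OF that] \<open>G w \<in> (\<Inter>U\<in>\<F>. W U)\<close> that by simp
      then show ?thesis using F(3) by auto
    qed
  qed
qed

definition \<Phi> :: "(rat \<Rightarrow> real) \<times> (rat \<Rightarrow> real) \<Rightarrow> 'a option set"
  where "\<Phi> p = {None, Some (inv G p), Some (fibre_root (inv G p))}"

lemma \<Phi>_G [simp]: "\<Phi> (G x) = {None, Some x, Some (fibre_root x)}"
  by (simp add: \<Phi>_def inv_f_f[OF inj_G])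

lemma usc_\<Phi>:
  "upper_semicontinuous (top_of_set (range G)) (Alexandroff_compactification tree_topology) \<Phi>"
  unfolding upper_semicontinuous_def
proof (intro conjI allI impI ballI)
  fix p show "\<Phi> p \<subseteq> topspace (Alexandroff_compactification tree_topology)"
    by (auto simp: \<Phi>_def)
next
  fix V :: "'a option set" assume "openin (Alexandroff_compactification tree_topology) V"
  \<comment> \<open>Every value of \<open>\<Phi>\<close> contains \<open>None\<close>, so a
    \<open>V\<close> without \<open>None\<close> gives the empty set, and otherwise \<open>V\<close>
    is the complement of a compact set.\<close>
  then consider "None \<notin> V" | C where "compactin tree_topology C" "V = insert None (Some ` (UNIV - C))"
    unfolding openin_Alexandroff_compactification by auto
  then show "openin (top_of_set (range G)) {s \<in> topspace (top_of_set (range G)). \<Phi> s \<subseteq> V}"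
  proof cases
    case 1
    then have "{s \<in> topspace (top_of_set (range G)). \<Phi> s \<subseteq> V} = {}" by (auto simp: \<Phi>_def)
    then show ?thesis by (simp only: openin_empty)
  next
    case 2
    show ?thesis
    proof (subst openin_subopen, intro ballI)
      fix p assume "p \<in> {s \<in> topspace (top_of_set (range G)). \<Phi> s \<subseteq> V}"
      then obtain x where x: "p = G x" "x \<notin> C" "fibre_root x \<notin> C" using 2(2) by auto
      obtain W where W: "open W" "G x \<in> W" "\<And>w. G w \<in> W \<Longrightarrow> w \<notin> C \<and> fibre_root w \<notin> C"
        using separate_compact[OF 2(1) x(2,3)] by blast
      show "\<exists>T. openin (top_of_set (range G)) T \<and> p \<in> T \<and>
          T \<subseteq> {s \<in> topspace (top_of_set (range G)). \<Phi> s \<subseteq> V}"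
      proof (intro exI conjI)
        show "openin (top_of_set (range G)) (range G \<inter> W)" using W(1) by (rule openin_open_Int)
        show "p \<in> range G \<inter> W" using W(2) x(1) by simp
        show "range G \<inter> W \<subseteq> {s \<in> topspace (top_of_set (range G)). \<Phi> s \<subseteq> V}"
          using W(3) 2(2) by auto
      qed
    qed
  qed
qed

lemma n_determined_3: "n_determined 3 (Alexandroff_compactification (tree_topology :: 'a topology))"
proof (rule n_determinedI)
  let ?S = "top_of_set (range G)"
  show "compact_space (Alexandroff_compactification (tree_topology :: 'a topology))"
    by (rule compact_space_Alexandroff_compactification)
  show "Hausdorff_space (Alexandroff_compactification (tree_topology :: 'a topology))"
    using Hausdorff_tree_topology locally_compact_tree
    by (simp add: Hausdorff_space_Alexandroff_compactification)
  show "second_countable ?S"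
    by (rule second_countable_subtopology[OF second_countable_euclidean])
  show "Hausdorff_space ?S"
    by (simp add: Hausdorff_space_subtopology)
  show "upper_semicontinuous ?S (Alexandroff_compactification tree_topology) \<Phi>" by (rule usc_\<Phi>)
  show "finite (\<Phi> p) \<and> card (\<Phi> p) \<le> 3" for p
    by (simp add: \<Phi>_def card_insert_if)
  show "topspace (Alexandroff_compactification tree_topology) = (\<Union>s\<in>topspace ?S. \<Phi> s)"
    by (auto simp: image_iff)
qed

end

theorem theorem3p2:
  assumes "embeddable_tree TYPE('a::meet_tree) real_lex_real"
    and "(UNIV :: 'a set) \<lesssim> (UNIV :: nat set set)"
  shows "n_determined 3 (Alexandroff_compactification (tree_topology :: 'a topology))"
proof -
  have "(UNIV :: 'a set) \<lesssim> (UNIV :: real set)"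
    using assms(2) nat_sets_eqpoll_reals lepoll_trans eqpoll_imp_lepoll by blast
  then obtain h :: "'a \<Rightarrow> real" where h: "inj h" unfolding lepoll_def by blast
  obtain f :: "'a \<Rightarrow> real \<times> real" where f: "\<And>s t. s < t \<Longrightarrow> (f s, f t) \<in> real_lex_real"
    using assms(1) unfolding embeddable_tree_def by blast
  \<comment> \<open>The exponential makes the codes positive and keeps them injective.\<close>
  interpret lex_embedded_tree "\<lambda>x. exp (h x)" "\<lambda>x. fst (f x)" "\<lambda>x. snd (f x)"
  proof
    show "inj (\<lambda>x. exp (h x))" using h by (simp add: inj_def)
    show "fst (f s) \<le> fst (f t)" if "s \<le> t" for s t
      using f[of s t] that by (cases "s = t") (auto simp: order.strict_iff_order real_lex_real_def lex_prod_def case_prod_beta)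
    show "snd (f s) < snd (f t)" if "s < t" "fst (f s) = fst (f t)" for s t
      using f[OF that(1)] that(2) by (auto simp: real_lex_real_def lex_prod_def case_prod_beta)
  qed simp
  show ?thesis by (rule n_determined_3)
qed

end
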